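(* Let $G$ be a locally compact abelian Hausdorff group, $H$ a closed subgroup of $G$, $\varGamma$ the dual group of $G$, and $\varLambda\subseteq\varGamma$ the annihilator of $H$. Let $\mu$ be a regular finite non-negative Borel measure on $\varGamma$ and let $\alpha\in(0,\infty)$. Assume that $\varGamma$ is a Polish space. Then the set $\mathbf{P}(H)$ of trigonometric $H$-polynomials is dense in $L^\alpha(\mu)$ if and only if $\mu$ is concentrated on a transversal.
   Context: All groups are written additively; $\langle\gamma,x\rangle$ denotes the value of the character $\gamma\in\varGamma$ at $x\in G$. The annihilator of $H$ is $\varLambda:=\{\gamma\in\varGamma:\langle\gamma,y\rangle=1 \text{ for all } y\in H\}$, a closed subgroup of $\varGamma$. A trigonometric $H$-polynomial is a function $p:\varGamma\to\mathbb{C}$ that is a finite sum $p(\cdot)=\sum_k a_k\langle\cdot,y_k\rangle$ with $a_k\in\mathbb{C}$, $y_k\in H$; $\mathbf{P}(H)$ is the linear space of all of them. A Polish space is a separable topological space that can be metrized by a complete metric. A finite non-negative Borel measure $\mu$ on a Hausdorff space $X$ is regular if for every Borel set $B$ and every $\varepsilon>0$ there are a compact set $C$ and an open set $U$ with $C\subseteq B\subseteq U$ and $\mu(U\setminus C)<\varepsilon$. For $\alpha\in(0,\infty)$, $L^\alpha(\mu)$ is the metric space of ($\mu$-equivalence classes of) Borel measurable functions $f:\varGamma\to\mathbb{C}$ with $\int_\varGamma|f|^\alpha\,d\mu<\infty$, where convergence $f_n\to f$ means $\int_\varGamma|f_n-f|^\alpha\,d\mu\to0$. The measure $\mu$ is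 said to be concentrated on a transversal if there exists a Borel set $D\subseteq\varGamma$ such that $\mu(\varGamma\setminus D)=0$ and $D\cap(\lambda+D)=\emptyset$ for all $\lambda\in\varLambda\setminus\{0\}$. *)

theory Defs
  imports "HOL-Analysis.Analysis"
begin

text \<open>
  The dual group of a topological abelian group: the continuous characters
  with values in the unit circle, with pointwise multiplication written additively.
\<close>

typedef (overloaded) ('a::topological_ab_group_add) dual_group =
  "{\<gamma> :: 'a \<Rightarrow> complex. continuous_on UNIV \<gamma> \<and> (\<forall>x. cmod (\<gamma> x) = 1) \<and>
      (\<forall>x y. \<gamma> (x + y) = \<gamma> x * \<gamma> y)}"
  morphisms char_val Abs_dual_group
  by (rule exI[of _ "\<lambda>_. 1"]) auto

setup_lifting type_definition_dual_group

instantiation dual_group :: (topological_ab_group_add) ab_group_add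
begin

lift_definition zero_dual_group :: "'a dual_group" is "\<lambda>_. 1"
  by auto

lift_definition plus_dual_group :: "'a dual_group \<Rightarrow> 'a dual_group \<Rightarrow> 'a dual_group"
  is "\<lambda>\<gamma> \<delta> x. \<gamma> x * \<delta> x"
  by (auto intro!: continuous_intros simp: norm_mult)

lift_definition uminus_dual_group :: "'a dual_group \<Rightarrow> 'a dual_group"
  is "\<lambda>\<gamma> x. inverse (\<gamma> x)"
  by (auto intro!: continuous_on_inverse simp: norm_inverse) (metis norm_zero zero_neq_one)

definition minus_dual_group :: "'a dual_group \<Rightarrow> 'a dual_group \<Rightarrow> 'a dual_group"
  where "minus_dual_group \<gamma> \<delta> = \<gamma> + - \<delta>"

instance
proof
  fix a b c :: "'a dual_group"
  show "a + b + c = a + (b + c)" by transfer (simp add: mult.assoc)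
  show "a + b = b + a" by transfer (simp add: mult.commute)
  show "0 + a = a" by transfer simp
  show "- a + a = 0"
  proof transfer
    fix a :: "'a \<Rightarrow> complex"
    assume "continuous_on UNIV a \<and> (\<forall>x. cmod (a x) = 1) \<and> (\<forall>x y. a (x + y) = a x * a y)"
    then have "a x \<noteq> 0" for x by (metis norm_zero zero_neq_one)
    then show "(\<lambda>x. inverse (a x) * a x) = (\<lambda>_. 1)" by simp
  qed
  show "a - b = a + - b" by (rule minus_dual_group_def)
qed

end

text \<open>The topology on the dual group is the compact-open topology.\<close>

instantiation dual_group :: (topological_ab_group_add) topological_space
begin

definition open_dual_group :: "'a dual_group set \<Rightarrow> bool" where
  "open_dual_group =
     generate_topology {{\<gamma>. char_val \<gamma> ` K \<subseteq> U} | K U. compact K \<and> open U}"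

instance
  by standard
    (auto simp: open_dual_group_def intro: generate_topology.UNIV generate_topology.Int
      generate_topology.UN)

end

instance dual_group :: (topological_ab_group_add) t2_space
proof
  fix \<gamma> \<delta> :: "'a dual_group"
  assume "\<gamma> \<noteq> \<delta>"
  then obtain x where "char_val \<gamma> x \<noteq> char_val \<delta> x"
    by (metis char_val_inject ext)
  then obtain U V where UV: "open U" "open V" "char_val \<gamma> x \<in> U" "char_val \<delta> x \<in> V" "U \<inter> V = {}"
    by (metis hausdorff)
  have *: "open {\<eta> :: 'a dual_group. char_val \<eta> x \<in> W}" if "open W" for W
  proof -
    have "{\<eta> :: 'a dual_group. char_val \<eta> x \<in> W} = {\<eta>. char_val \<eta> ` {x} \<subseteq> W}" by simp
    then show ?thesis
      unfolding open_dual_group_def using that compact_sing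
      by (intro generate_topology.Basis) blast
  qed
  show "\<exists>U V. open U \<and> open V \<and> \<gamma> \<in> U \<and> \<delta> \<in> V \<and> U \<inter> V = {}"
    using *[OF UV(1)] *[OF UV(2)] UV(3-5)
    by (intro exI[of _ "{\<eta>. char_val \<eta> x \<in> U}"] exI[of _ "{\<eta>. char_val \<eta> x \<in> V}"]) auto
qed

definition additive_subgroup :: "'a::ab_group_add set \<Rightarrow> bool" where
  "additive_subgroup H \<longleftrightarrow>
     0 \<in> H \<and> (\<forall>x\<in>H. \<forall>y\<in>H. x + y \<in> H) \<and> (\<forall>x\<in>H. - x \<in> H)"

definition annihilator :: "'a::topological_ab_group_add set \<Rightarrow> 'a dual_group set" where
  "annihilator H = {\<gamma>. \<forall>y\<in>H. char_val \<gamma> y = 1}"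

definition trig_polys :: "'a::topological_ab_group_add set \<Rightarrow> ('a dual_group \<Rightarrow> complex) set" where
  "trig_polys H = {p. \<exists>(n::nat) a y. (\<forall>k<n. y k \<in> H) \<and>
      p = (\<lambda>\<gamma>. \<Sum>k<n. a k * char_val \<gamma> (y k))}"

definition polish_topology :: "'a topology \<Rightarrow> bool" where
  "polish_topology X \<longleftrightarrow> separable_space X \<and> completely_metrizable_space X"

definition regular_borel_measure :: "'a::t2_space measure \<Rightarrow> bool" where
  "regular_borel_measure \<mu> \<longleftrightarrow> sets \<mu> = sets borel \<and> finite_measure \<mu> \<and>
     (\<forall>B\<in>sets borel. \<forall>\<epsilon>>0. \<exists>C U. compact C \<and> open U \<and> C \<subseteq> B \<and> B \<subseteq> U \<and>
        measure \<mu> (U - C) < \<epsilon>)"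

text \<open>
  \<open>L\<^sup>\<alpha>(\<mu>)\<close> is handled through representatives: its convergence only depends on
  the equivalence classes of the functions modulo equality almost everywhere, so density
  of a set of functions means that every element is a limit of a sequence from that set.
\<close>

definition Lspace :: "real \<Rightarrow> 'a measure \<Rightarrow> ('a \<Rightarrow> complex) set" where
  "Lspace \<alpha> \<mu> = {f \<in> borel_measurable \<mu>. (\<integral>\<^sup>+x. ennreal (cmod (f x) powr \<alpha>) \<partial>\<mu>) < \<infinity>}"

definition Lconverges ::
  "real \<Rightarrow> 'a measure \<Rightarrow> (nat \<Rightarrow> 'a \<Rightarrow> complex) \<Rightarrow> ('a \<Rightarrow> complex) \<Rightarrow> bool" where
  "Lconverges \<alpha> \<mu> F f \<longleftrightarrow>
     (\<lambda>n. \<integral>\<^sup>+x. ennreal (cmod (F n x - f x) powr \<alpha>) \<partial>\<mu>) \<longlonglongrightarrow> 0"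

definition dense_in_Lspace :: "real \<Rightarrow> 'a measure \<Rightarrow> ('a \<Rightarrow> complex) set \<Rightarrow> bool" where
  "dense_in_Lspace \<alpha> \<mu> P \<longleftrightarrow> P \<subseteq> Lspace \<alpha> \<mu> \<and>
     (\<forall>f\<in>Lspace \<alpha> \<mu>. \<exists>F. (\<forall>n. F n \<in> P) \<and> Lconverges \<alpha> \<mu> F f)"

definition concentrated_on_transversal ::
  "'a::topological_ab_group_add set \<Rightarrow> 'a dual_group measure \<Rightarrow> bool" where
  "concentrated_on_transversal H \<mu> \<longleftrightarrow>
     (\<exists>D\<in>sets borel. emeasure \<mu> (- D) = 0 \<and>
        (\<forall>\<delta>\<in>annihilator H - {0}. D \<inter> (+) \<delta> ` D = {}))"

end

theory Submission
  imports Defs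
begin

text \<open>
  The restriction of characters to \<open>H\<close> cannot tell two points of the same coset of the
  annihilator \<open>\<Lambda>\<close> apart, so every \<open>H\<close>-polynomial is constant on these cosets. The theorem says
  that density holds exactly when \<open>\<mu>\<close> does not see this obstruction.

  If the polynomials are dense, a countable family of open sets that separates the points of the
  Polish space (\<open>polish_countable_separating_opens\<close>) has indicators that are all limits in
  \<open>L\<^sup>\<alpha>(\<mu>)\<close>, hence along subsequences almost everywhere limits, of \<open>H\<close>-polynomials
  (\<open>Lconverges_AE_subseq\<close>). Off one common null set these indicators are therefore constant on
  cosets of \<open>\<Lambda>\<close>, while they separate points: the complement of the null set is the transversal.

  Conversely, let \<open>\<mu>\<close> be concentrated on the transversal \<open>D\<close>. On a compact subset \<open>C\<close> of \<open>D\<close> the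
  \<open>H\<close>-polynomials form a self-adjoint algebra that contains the constants and separates points, so
  they are uniformly dense in the continuous functions on \<open>C\<close>. The difficulty is the
  complement of \<open>C\<close>: it has small measure, but the approximants may be large there, and improving
  the approximation changes them. The remedy is to truncate, that is, to compose a real
  approximant with a polynomial that is close to a clamping function on the range of the
  approximant; the result is still an \<open>H\<close>-polynomial and is bounded on the whole dual group
  independently of the quality of the approximation (\<open>Stone_Weierstrass_bounded\<close>).
  For the indicator of a Borel set
  \<open>B\<close>, regularity supplies compact sets \<open>C1 \<subseteq> D \<inter> B\<close> and \<open>C2 \<subseteq> D - B\<close> that nearly exhaust \<open>\<mu>\<close>; as
  they are disjoint, the indicator is continuous on \<open>C = C1 \<union> C2\<close> and can be approximated
  (\<open>indicator_in_Lclosure_trig_polys\<close>). Simple functions are dense, which gives all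
  of \<open>L\<^sup>\<alpha>(\<mu>)\<close> (\<open>Lspace_subset_Lclosure\<close>).
\<close>

section \<open>Trigonometric polynomials\<close>

lemma char_val_add_left: "char_val (\<gamma> + \<delta>) x = char_val \<gamma> x * char_val \<delta> x"
  by transfer simp

lemma norm_char_val [simp]: "cmod (char_val \<gamma> x) = 1"
  by transfer simp

lemma char_val_add: "char_val \<gamma> (x + y) = char_val \<gamma> x * char_val \<gamma> y"
  by transfer simp

lemma char_val_zero [simp]: "char_val \<gamma> 0 = 1"
proof -
  have "char_val \<gamma> 0 * char_val \<gamma> 0 = char_val \<gamma> 0 * 1" "char_val \<gamma> 0 \<noteq> 0"
    using char_val_add[of \<gamma> 0 0] by (simp, metis norm_char_val norm_zero zero_neq_one)
  then show ?thesis by (metis mult_left_cancel)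
qed

lemma cnj_char_val: "cnj (char_val \<gamma> x) = char_val \<gamma> (- x)"
proof -
  have "char_val \<gamma> x * char_val \<gamma> (- x) = 1"
    using char_val_add[of \<gamma> x "- x"] by simp
  moreover have "char_val \<gamma> x * cnj (char_val \<gamma> x) = 1"
    using complex_norm_square[of "char_val \<gamma> x"] by simp
  moreover have "char_val \<gamma> x \<noteq> 0"
    using norm_char_val[of \<gamma> x] by force
  ultimately show ?thesis
    by (metis mult_left_cancel)
qed

text \<open>Points are compact, so the compact-open topology refines that of pointwise convergence.\<close>

lemma continuous_char_val: "continuous_on UNIV (\<lambda>\<gamma>. char_val \<gamma> x)"
proof -
  have "open ((\<lambda>\<gamma> :: 'a::topological_ab_group_add dual_group. char_val \<gamma> x) -` W)"
    if "open W" for W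
  proof -
    have "(\<lambda>\<gamma> :: 'a dual_group. char_val \<gamma> x) -` W = {\<gamma>. char_val \<gamma> ` {x} \<subseteq> W}"
      by auto
    then show ?thesis
      unfolding open_dual_group_def using that compact_sing
      by (intro generate_topology.Basis) blast
  qed
  then show ?thesis
    by (simp add: continuous_on_open_vimage)
qed

lemma trig_polys_zero: "(\<lambda>\<gamma>. 0) \<in> trig_polys H"
  unfolding trig_polys_def by (force intro: exI[of _ 0])

lemma trig_polys_add_monomial:
  assumes "p \<in> trig_polys H" "x \<in> H"
  shows "(\<lambda>\<gamma>. p \<gamma> + c * char_val \<gamma> x) \<in> trig_polys H"
proof -
  obtain n :: nat and a y where "\<forall>k<n. y k \<in> H" "p = (\<lambda>\<gamma>. \<Sum>k<n. a k * char_val \<gamma> (y k))"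
    using assms(1) by (auto simp: trig_polys_def)
  then show ?thesis
    unfolding trig_polys_def using assms(2)
    by (intro CollectI exI[of _ "Suc n"] exI[of _ "a(n := c)"] exI[of _ "y(n := x)"])
      (auto simp: less_Suc_eq)
qed

lemma trig_polys_add:
  assumes "p \<in> trig_polys H" "q \<in> trig_polys H"
  shows "(\<lambda>\<gamma>. p \<gamma> + q \<gamma>) \<in> trig_polys H"
proof -
  obtain n :: nat and a y where y: "\<forall>k<n. y k \<in> H"
    and q: "q = (\<lambda>\<gamma>. \<Sum>k<n. a k * char_val \<gamma> (y k))"
    using assms(2) by (auto simp: trig_polys_def)
  have "(\<lambda>\<gamma>. p \<gamma> + (\<Sum>k<m. a k * char_val \<gamma> (y k))) \<in> trig_polys H" if "m \<le> n" for m
    using that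
  proof (induction m)
    case (Suc m)
    then show ?case
      using trig_polys_add_monomial[of "\<lambda>\<gamma>. p \<gamma> + (\<Sum>k<m. a k * char_val \<gamma> (y k))" H "y m" "a m"] y
      by (simp add: add.assoc)
  qed (use assms in simp)
  then show ?thesis unfolding q by blast
qed

lemma trig_polys_sum:
  assumes "\<And>i. i \<in> I \<Longrightarrow> p i \<in> trig_polys H"
  shows "(\<lambda>\<gamma>. \<Sum>i\<in>I. p i \<gamma>) \<in> trig_polys H"
  using assms
  by (induction I rule: infinite_finite_induct) (auto intro: trig_polys_zero trig_polys_add)

lemma trig_polys_monomial: "x \<in> H \<Longrightarrow> (\<lambda>\<gamma>. c * char_val \<gamma> x) \<in> trig_polys H"
  using trig_polys_add_monomial[OF trig_polys_zero] by simp

lemma trig_polys_const: "additive_subgroup H \<Longrightarrow> (\<lambda>\<gamma>. c) \<in> trig_polys H"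
  using trig_polys_monomial[of 0 H c] by (simp add: additive_subgroup_def)

lemma trig_polys_mult:
  assumes H: "additive_subgroup H" and "p \<in> trig_polys H" "q \<in> trig_polys H"
  shows "(\<lambda>\<gamma>. p \<gamma> * q \<gamma>) \<in> trig_polys H"
proof -
  obtain n :: nat and a y where y: "\<forall>k<n. y k \<in> H"
    and p: "p = (\<lambda>\<gamma>. \<Sum>k<n. a k * char_val \<gamma> (y k))"
    using assms(2) by (auto simp: trig_polys_def)
  obtain m :: nat and b z where z: "\<forall>k<m. z k \<in> H"
    and q: "q = (\<lambda>\<gamma>. \<Sum>k<m. b k * char_val \<gamma> (z k))"
    using assms(3) by (auto simp: trig_polys_def)
  have "(\<lambda>\<gamma>. \<Sum>i<n. \<Sum>j<m. (a i * b j) * char_val \<gamma> (y i + z j)) \<in> trig_polys H"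
    using y z H by (intro trig_polys_sum trig_polys_monomial) (auto simp: additive_subgroup_def)
  then show ?thesis
    by (simp add: p q sum_product char_val_add mult_ac)
qed

lemma continuous_trig_poly: "p \<in> trig_polys H \<Longrightarrow> continuous_on UNIV p"
  unfolding trig_polys_def
  by (auto intro!: continuous_intros continuous_char_val)

lemma bounded_trig_poly: "p \<in> trig_polys H \<Longrightarrow> \<exists>B. \<forall>\<gamma>. cmod (p \<gamma>) \<le> B"
proof -
  assume "p \<in> trig_polys H"
  then obtain n :: nat and a y where p: "p = (\<lambda>\<gamma>. \<Sum>k<n. a k * char_val \<gamma> (y k))"
    by (auto simp: trig_polys_def)
  have "cmod (p \<gamma>) \<le> (\<Sum>k<n. cmod (a k))" for \<gamma>
    unfolding p by (rule sum_norm_le) (simp add: norm_mult)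
  then show ?thesis by blast
qed

text \<open>This invariance is the obstruction to density.\<close>

lemma trig_poly_annihilator_invariant:
  assumes "p \<in> trig_polys H" "\<delta> \<in> annihilator H"
  shows "p (\<delta> + \<gamma>) = p \<gamma>"
  using assms by (auto simp: trig_polys_def annihilator_def char_val_add_left intro!: sum.cong)

text \<open>
  Some character given by \<open>y \<in> H\<close> separates points of different cosets, hence so does its real or
  its imaginary part; both are \<open>H\<close>-polynomials because conjugation replaces \<open>y\<close> by \<open>- y\<close>.
\<close>

lemma real_trig_polys_separate:
  assumes H: "additive_subgroup H" and "\<gamma> - \<delta> \<notin> annihilator H"
  shows "\<exists>r. (\<lambda>\<eta>. complex_of_real (r \<eta>)) \<in> trig_polys H \<and> r \<gamma> \<noteq> r \<delta>"
proof -
  obtain y where y: "y \<in> H" "char_val (\<gamma> - \<delta>) y \<noteq> 1"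
    using assms(2) by (auto simp: annihilator_def)
  have ne: "char_val \<gamma> y \<noteq> char_val \<delta> y"
  proof
    assume "char_val \<gamma> y = char_val \<delta> y"
    moreover have "char_val \<gamma> y = char_val (\<gamma> - \<delta>) y * char_val \<delta> y"
      by (metis char_val_add_left diff_add_cancel)
    moreover have "char_val \<delta> y \<noteq> 0"
      using norm_char_val[of \<delta> y] by force
    ultimately show False using y by simp
  qed
  have my: "- y \<in> H" using H y by (auto simp: additive_subgroup_def)
  have "(\<lambda>\<eta>. 1/2 * char_val \<eta> y + 1/2 * char_val \<eta> (- y)) \<in> trig_polys H"
    by (intro trig_polys_add trig_polys_monomial y my)
  moreover have "1/2 * char_val \<eta> y + 1/2 * char_val \<eta> (- y) = complex_of_real (Re (char_val \<eta> y))" for \<eta>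
    by (simp add: cnj_char_val[symmetric] complex_eq_iff)
  ultimately have re: "(\<lambda>\<eta>. complex_of_real (Re (char_val \<eta> y))) \<in> trig_polys H"
    by simp
  have "(\<lambda>\<eta>. (- \<i>/2) * char_val \<eta> y + (\<i>/2) * char_val \<eta> (- y)) \<in> trig_polys H"
    by (intro trig_polys_add trig_polys_monomial y my)
  moreover have "(- \<i>/2) * char_val \<eta> y + (\<i>/2) * char_val \<eta> (- y) = complex_of_real (Im (char_val \<eta> y))" for \<eta>
    by (simp add: cnj_char_val[symmetric] complex_eq_iff)
  ultimately have im: "(\<lambda>\<eta>. complex_of_real (Im (char_val \<eta> y))) \<in> trig_polys H"
    by simp
  show ?thesis
    using re im ne by (auto simp: complex_eq_iff intro: exI[of _ "\<lambda>\<eta>. Re (char_val \<eta> y)"])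
qed

section \<open>Uniform approximation with a global bound\<close>

text \<open>
  The Stone--Weierstrass theorem with control off the compact set. Clamping to \<open>[- M, M]\<close> does not
  increase the distance to \<open>f\<close> on \<open>C\<close> and bounds the approximant everywhere. The clamping function
  is not available inside the algebra, but on the bounded range of an element \<open>r\<close> of \<open>R\<close> it is
  uniformly close to a polynomial, and polynomials in \<open>r\<close> belong to \<open>R\<close>.
\<close>

lemma Stone_Weierstrass_bounded:
  fixes R :: "('a::t2_space \<Rightarrow> real) set" and f :: "'a \<Rightarrow> real"
  assumes cont: "\<And>r. r \<in> R \<Longrightarrow> continuous_on C r"
    and bdd: "\<And>r. r \<in> R \<Longrightarrow> \<exists>B. \<forall>x. \<bar>r x\<bar> \<le> B"
    and const: "\<And>c. (\<lambda>_. c) \<in> R"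
    and add: "\<And>r s. r \<in> R \<Longrightarrow> s \<in> R \<Longrightarrow> (\<lambda>x. r x + s x) \<in> R"
    and mult: "\<And>r s. r \<in> R \<Longrightarrow> s \<in> R \<Longrightarrow> (\<lambda>x. r x * s x) \<in> R"
    and sep: "\<And>x y. x \<in> C \<Longrightarrow> y \<in> C \<Longrightarrow> x \<noteq> y \<Longrightarrow> \<exists>r\<in>R. r x \<noteq> r y"
    and C: "compact C" and f: "continuous_on C f" and f1: "\<And>x. x \<in> C \<Longrightarrow> \<bar>f x\<bar> \<le> M"
    and M: "0 \<le> M" and e: "0 < e"
  shows "\<exists>g\<in>R. (\<forall>x\<in>C. \<bar>g x - f x\<bar> < e) \<and> (\<forall>x. \<bar>g x\<bar> \<le> M + e)"
proof -
  interpret function_ring_on R C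
    by unfold_locales (fact C cont add mult const sep)+
  obtain r where r: "r \<in> R" "\<And>x. x \<in> C \<Longrightarrow> \<bar>f x - r x\<bar> < e / 2"
    using Stone_Weierstrass_basic[OF f, of "e / 2"] e by auto
  obtain B where B: "\<And>x. \<bar>r x\<bar> \<le> B"
    using bdd[OF r(1)] by blast
  define T :: "real \<Rightarrow> real" where "T t = max (- M) (min M t)" for t
  have T: "continuous_on {-B..B} T"
    unfolding T_def by (intro continuous_intros)
  obtain q where q: "real_polynomial_function q" "\<And>t. t \<in> {-B..B} \<Longrightarrow> \<bar>T t - q t\<bar> < e / 2"
    using Stone_Weierstrass_real_polynomial_function[OF _ T, of "e / 2"] e by auto
  have qR: "(\<lambda>x. q (r x)) \<in> R"
    using q(1)
  proof induction
    case (linear l)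
    have "l (r x) = r x * l 1" for x
      using linear_simps(5)[OF linear, of "r x" 1] by simp
    then have "(\<lambda>x. l (r x)) = (\<lambda>x. r x * l 1)"
      by (rule ext)
    then show ?case
      using mult[OF r(1) const[of "l 1"]] by simp
  qed (auto intro: const add mult)
  have qT: "\<bar>T (r x) - q (r x)\<bar> < e / 2" for x
    using B[of x] by (intro q(2)) auto
  show ?thesis
  proof (intro bexI[OF _ qR] conjI ballI allI)
    fix x assume x: "x \<in> C"
    have "\<bar>T (r x) - f x\<bar> \<le> \<bar>r x - f x\<bar>"
      using f1[OF x] unfolding T_def by (auto simp: max_def min_def)
    then show "\<bar>q (r x) - f x\<bar> < e"
      using qT[of x] r(2)[OF x] by linarith
  next
    fix x
    have "\<bar>T (r x)\<bar> \<le> M"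
      using M unfolding T_def by (auto simp: max_def min_def)
    then show "\<bar>q (r x)\<bar> \<le> M + e"
      using qT[of x] e by linarith
  qed
qed

section \<open>Convergence and closure in \<open>L\<^sup>\<alpha>\<close>\<close>

text \<open>
  For \<open>\<alpha> > 1\<close> this is the \<open>\<alpha>\<close>-th power of the usual metric. It satisfies the triangle inequality
  only up to the factor \<open>2 powr \<alpha>\<close>, but it treats all \<open>\<alpha> > 0\<close> uniformly.
\<close>

definition Ldist :: "real \<Rightarrow> 'a measure \<Rightarrow> ('a \<Rightarrow> complex) \<Rightarrow> ('a \<Rightarrow> complex) \<Rightarrow> ennreal" where
  "Ldist \<alpha> \<mu> f g = (\<integral>\<^sup>+x. ennreal (cmod (f x - g x) powr \<alpha>) \<partial>\<mu>)"

text \<open>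
  Estimating the sum by twice the maximum works for every \<open>\<alpha> > 0\<close>, on either side of the threshold
  \<open>\<alpha> = 1\<close> where the power function changes from concave to convex.
\<close>

lemma cmod_add_powr_le:
  assumes "\<alpha> > 0"
  shows "cmod (a + b) powr \<alpha> \<le> 2 powr \<alpha> * (cmod a powr \<alpha> + cmod b powr \<alpha>)"
proof -
  have "cmod (a + b) \<le> 2 * max (cmod a) (cmod b)"
    using norm_triangle_ineq[of a b] by linarith
  then have "cmod (a + b) powr \<alpha> \<le> (2 * max (cmod a) (cmod b)) powr \<alpha>"
    using assms by (intro powr_mono2) auto
  also have "\<dots> = 2 powr \<alpha> * max (cmod a) (cmod b) powr \<alpha>"
    by (simp add: powr_mult)
  also have "\<dots> \<le> 2 powr \<alpha> * (cmod a powr \<alpha> + cmod b powr \<alpha>)"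
    by (intro mult_left_mono) (auto simp: max_def)
  finally show ?thesis .
qed

lemma nn_integral_cmod_add_powr_le:
  assumes "\<alpha> > 0" and [measurable]: "f \<in> borel_measurable \<mu>" "g \<in> borel_measurable \<mu>"
  shows "(\<integral>\<^sup>+x. ennreal (cmod (f x + g x) powr \<alpha>) \<partial>\<mu>) \<le>
    ennreal (2 powr \<alpha>) * ((\<integral>\<^sup>+x. ennreal (cmod (f x) powr \<alpha>) \<partial>\<mu>) + (\<integral>\<^sup>+x. ennreal (cmod (g x) powr \<alpha>) \<partial>\<mu>))"
proof -
  have "(\<integral>\<^sup>+x. ennreal (cmod (f x + g x) powr \<alpha>) \<partial>\<mu>) \<le>
    (\<integral>\<^sup>+x. ennreal (2 powr \<alpha>) * (ennreal (cmod (f x) powr \<alpha>) + ennreal (cmod (g x) powr \<alpha>)) \<partial>\<mu>)"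
    by (intro nn_integral_mono)
      (simp add: cmod_add_powr_le[OF assms(1)] flip: ennreal_plus ennreal_mult)
  also have "\<dots> = ennreal (2 powr \<alpha>) * ((\<integral>\<^sup>+x. ennreal (cmod (f x) powr \<alpha>) \<partial>\<mu>) + (\<integral>\<^sup>+x. ennreal (cmod (g x) powr \<alpha>) \<partial>\<mu>))"
    by (simp add: nn_integral_cmult nn_integral_add)
  finally show ?thesis .
qed

lemma Ldist_triangle:
  assumes "\<alpha> > 0" and "f \<in> borel_measurable \<mu>" "g \<in> borel_measurable \<mu>" "h \<in> borel_measurable \<mu>"
  shows "Ldist \<alpha> \<mu> f h \<le> ennreal (2 powr \<alpha>) * (Ldist \<alpha> \<mu> f g + Ldist \<alpha> \<mu> g h)"
  using nn_integral_cmod_add_powr_le[of \<alpha> "\<lambda>x. f x - g x" \<mu> "\<lambda>x. g x - h x"] assms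
  unfolding Ldist_def by simp

lemma Ldist_add:
  assumes "\<alpha> > 0" and "f \<in> borel_measurable \<mu>" "g \<in> borel_measurable \<mu>"
    "f' \<in> borel_measurable \<mu>" "g' \<in> borel_measurable \<mu>"
  shows "Ldist \<alpha> \<mu> (\<lambda>x. f x + g x) (\<lambda>x. f' x + g' x) \<le>
    ennreal (2 powr \<alpha>) * (Ldist \<alpha> \<mu> f f' + Ldist \<alpha> \<mu> g g')"
  using nn_integral_cmod_add_powr_le[of \<alpha> "\<lambda>x. f x - f' x" \<mu> "\<lambda>x. g x - g' x"] assms
  unfolding Ldist_def by (simp add: algebra_simps)

lemma Ldist_scale:
  assumes "f \<in> borel_measurable \<mu>" "g \<in> borel_measurable \<mu>"
  shows "Ldist \<alpha> \<mu> (\<lambda>x. c * f x) (\<lambda>x. c * g x) = ennreal (cmod c powr \<alpha>) * Ldist \<alpha> \<mu> f g"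
proof -
  note [measurable] = assms
  have "cmod (c * f x - c * g x) powr \<alpha> = cmod c powr \<alpha> * cmod (f x - g x) powr \<alpha>" for x
    by (simp add: powr_mult norm_mult flip: right_diff_distrib)
  then show ?thesis
    unfolding Ldist_def by (simp add: ennreal_mult nn_integral_cmult)
qed

lemma Ldist_finite:
  assumes "\<alpha> > 0" "f \<in> Lspace \<alpha> \<mu>" "g \<in> Lspace \<alpha> \<mu>"
  shows "Ldist \<alpha> \<mu> f g < \<infinity>"
proof -
  have "Ldist \<alpha> \<mu> f g \<le> ennreal (2 powr \<alpha>) * (Ldist \<alpha> \<mu> f (\<lambda>_. 0) + Ldist \<alpha> \<mu> (\<lambda>_. 0) g)"
    using assms by (intro Ldist_triangle) (auto simp: Lspace_def)
  also have "\<dots> < \<infinity>"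
    using assms by (auto simp: Lspace_def Ldist_def ennreal_mult_less_top)
  finally show ?thesis .
qed

text \<open>
  The functions \<open>\<bar>F n - f\<bar> powr \<alpha>\<close> converge to zero in \<open>L\<^sup>1\<close>, and convergence in \<open>L\<^sup>1\<close>
  implies convergence almost everywhere along a subsequence.
\<close>

lemma Lconverges_AE_subseq:
  assumes "\<alpha> > 0" "\<And>n. F n \<in> Lspace \<alpha> \<mu>" "f \<in> Lspace \<alpha> \<mu>" "Lconverges \<alpha> \<mu> F f"
  shows "\<exists>s. AE x in \<mu>. (\<lambda>n. F (s n) x) \<longlonglongrightarrow> f x"
proof -
  have [measurable]: "f \<in> borel_measurable \<mu>" "F n \<in> borel_measurable \<mu>" for n
    using assms by (auto simp: Lspace_def)
  define u where "u n x = cmod (F n x - f x) powr \<alpha>" for n x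
  have int: "integrable \<mu> (u n)" for n
    using Ldist_finite[OF assms(1) assms(2)[of n] assms(3)]
    unfolding Ldist_def u_def integrable_iff_bounded by simp
  have "(\<lambda>n. ennreal (\<integral>x. u n x \<partial>\<mu>)) \<longlonglongrightarrow> ennreal 0"
    using assms(4) int unfolding Lconverges_def u_def
    by (simp add: nn_integral_eq_integral)
  then have "(\<lambda>n. \<integral>x. norm (u n x) \<partial>\<mu>) \<longlonglongrightarrow> 0"
    by (subst (asm) tendsto_ennreal_iff) (auto simp: u_def[abs_def])
  from tendsto_L1_AE_subseq[OF int this]
  obtain s where s: "AE x in \<mu>. (\<lambda>n. u (s n) x) \<longlonglongrightarrow> 0"
    by auto
  have "(\<lambda>n. F (s n) x) \<longlonglongrightarrow> f x" if "(\<lambda>n. u (s n) x) \<longlonglongrightarrow> 0" for x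
  proof -
    have "(\<lambda>n. u (s n) x powr (1 / \<alpha>)) \<longlonglongrightarrow> 0 powr (1 / \<alpha>)"
      using that assms(1) by (intro tendsto_powr2) (auto simp: u_def)
    then have "(\<lambda>n. cmod (F (s n) x - f x)) \<longlonglongrightarrow> 0"
      using assms(1) by (simp add: u_def powr_powr)
    then show ?thesis
      by (simp add: tendsto_norm_zero_iff LIM_zero_iff)
  qed
  then have "AE x in \<mu>. (\<lambda>n. F (s n) x) \<longlonglongrightarrow> f x"
    using s by (auto elim: eventually_mono)
  then show ?thesis by blast
qed

definition Lclosure :: "real \<Rightarrow> 'a measure \<Rightarrow> ('a \<Rightarrow> complex) set \<Rightarrow> ('a \<Rightarrow> complex) set" where
  "Lclosure \<alpha> \<mu> P = {f \<in> borel_measurable \<mu>. \<forall>e>0. \<exists>p\<in>P. Ldist \<alpha> \<mu> p f < ennreal e}"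

lemma dense_in_Lspace_iff:
  "dense_in_Lspace \<alpha> \<mu> P \<longleftrightarrow> P \<subseteq> Lspace \<alpha> \<mu> \<and> Lspace \<alpha> \<mu> \<subseteq> Lclosure \<alpha> \<mu> P"
proof -
  have "(\<exists>F. (\<forall>n. F n \<in> P) \<and> Lconverges \<alpha> \<mu> F f) \<longleftrightarrow> f \<in> Lclosure \<alpha> \<mu> P"
    if f: "f \<in> Lspace \<alpha> \<mu>" for f
  proof
    assume "\<exists>F. (\<forall>n. F n \<in> P) \<and> Lconverges \<alpha> \<mu> F f"
    then obtain F where F: "\<And>n. F n \<in> P" "(\<lambda>n. Ldist \<alpha> \<mu> (F n) f) \<longlonglongrightarrow> 0"
      by (auto simp: Lconverges_def Ldist_def)
    have "\<exists>p\<in>P. Ldist \<alpha> \<mu> p f < ennreal e" if "e > 0" for e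
    proof -
      have "\<forall>\<^sub>F n in sequentially. Ldist \<alpha> \<mu> (F n) f < ennreal e"
        using order_tendstoD(2)[OF F(2)] that by simp
      then show ?thesis
        using F(1) by (auto simp: eventually_sequentially)
    qed
    then show "f \<in> Lclosure \<alpha> \<mu> P"
      using f by (auto simp: Lclosure_def Lspace_def)
  next
    assume "f \<in> Lclosure \<alpha> \<mu> P"
    then have "\<exists>p\<in>P. Ldist \<alpha> \<mu> p f < ennreal (1 / real (Suc n))" for n
      by (simp add: Lclosure_def)
    then obtain F where F: "\<And>n. F n \<in> P" "\<And>n. Ldist \<alpha> \<mu> (F n) f < ennreal (1 / real (Suc n))"
      by metis
    have lim: "(\<lambda>n. ennreal (1 / real (Suc n))) \<longlonglongrightarrow> ennreal 0"
      using LIMSEQ_inverse_real_of_nat by (intro tendsto_ennrealI) (simp add: inverse_eq_divide)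
    have le: "\<forall>\<^sub>F n in sequentially. Ldist \<alpha> \<mu> (F n) f \<le> ennreal (1 / real (Suc n))"
      by (intro always_eventually allI less_imp_le F(2))
    have "(\<lambda>n. Ldist \<alpha> \<mu> (F n) f) \<longlonglongrightarrow> 0"
      by (rule tendsto_sandwich[OF _ le tendsto_const lim[unfolded ennreal_0]]) simp
    then show "\<exists>F. (\<forall>n. F n \<in> P) \<and> Lconverges \<alpha> \<mu> F f"
      using F(1) by (auto simp: Lconverges_def Ldist_def)
  qed
  then show ?thesis
    by (auto simp: dense_in_Lspace_def)
qed

text \<open>A constant factor in front of the error is harmless; this absorbs the factor of the
  weak triangle inequality.\<close>

lemma Lclosure_bound:
  assumes "c \<ge> 0" "P \<subseteq> borel_measurable \<mu>" "f \<in> borel_measurable \<mu>"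
    and "\<And>e. e > 0 \<Longrightarrow> \<exists>p\<in>P. Ldist \<alpha> \<mu> p f \<le> ennreal c * ennreal e"
  shows "f \<in> Lclosure \<alpha> \<mu> P"
proof -
  have "\<exists>p\<in>P. Ldist \<alpha> \<mu> p f < ennreal e" if e: "e > 0" for e
  proof -
    obtain p where p: "p \<in> P" "Ldist \<alpha> \<mu> p f \<le> ennreal c * ennreal (e / (c + 1))"
      using assms(4)[of "e / (c + 1)"] e assms(1) by auto
    have "c * (e / (c + 1)) < e"
      using e assms(1) by (simp add: field_simps)
    then have "ennreal c * ennreal (e / (c + 1)) < ennreal e"
      using e assms(1) by (simp add: ennreal_lessI flip: ennreal_mult)
    then show ?thesis using p by (meson le_less_trans)
  qed
  then show ?thesis using assms(3) by (auto simp: Lclosure_def)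
qed

lemma Lclosure_add:
  assumes "\<alpha> > 0" "P \<subseteq> borel_measurable \<mu>"
    and P: "\<And>p q. p \<in> P \<Longrightarrow> q \<in> P \<Longrightarrow> (\<lambda>x. p x + q x) \<in> P"
    and f: "f \<in> Lclosure \<alpha> \<mu> P" and g: "g \<in> Lclosure \<alpha> \<mu> P"
  shows "(\<lambda>x. f x + g x) \<in> Lclosure \<alpha> \<mu> P"
proof (rule Lclosure_bound)
  have [measurable]: "f \<in> borel_measurable \<mu>" "g \<in> borel_measurable \<mu>"
    using f g by (auto simp: Lclosure_def)
  show "(\<lambda>x. f x + g x) \<in> borel_measurable \<mu>" by measurable
  fix e :: real assume e: "e > 0"
  obtain p q where pq: "p \<in> P" "Ldist \<alpha> \<mu> p f < ennreal (e / 2)" "q \<in> P" "Ldist \<alpha> \<mu> q g < ennreal (e / 2)"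
    using f g e by (auto simp: Lclosure_def) (meson half_gt_zero)
  have "Ldist \<alpha> \<mu> (\<lambda>x. p x + q x) (\<lambda>x. f x + g x) \<le>
      ennreal (2 powr \<alpha>) * (Ldist \<alpha> \<mu> p f + Ldist \<alpha> \<mu> q g)"
    using assms(1,2) pq by (intro Ldist_add) auto
  also have "\<dots> \<le> ennreal (2 powr \<alpha>) * (ennreal (e / 2) + ennreal (e / 2))"
    using pq by (intro mult_left_mono add_mono) auto
  also have "ennreal (e / 2) + ennreal (e / 2) = ennreal e"
    using e by (simp flip: ennreal_plus)
  finally show "\<exists>p\<in>P. Ldist \<alpha> \<mu> p (\<lambda>x. f x + g x) \<le> ennreal (2 powr \<alpha>) * ennreal e"
    using P[OF pq(1,3)] by blast
qed (use assms in auto)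

lemma Lclosure_scale:
  assumes "P \<subseteq> borel_measurable \<mu>"
    and P: "\<And>p. p \<in> P \<Longrightarrow> (\<lambda>x. c * p x) \<in> P"
    and f: "f \<in> Lclosure \<alpha> \<mu> P"
  shows "(\<lambda>x. c * f x) \<in> Lclosure \<alpha> \<mu> P"
proof (rule Lclosure_bound)
  have [measurable]: "f \<in> borel_measurable \<mu>"
    using f by (auto simp: Lclosure_def)
  show "(\<lambda>x. c * f x) \<in> borel_measurable \<mu>" by measurable
  fix e :: real assume e: "e > 0"
  obtain p where p: "p \<in> P" "Ldist \<alpha> \<mu> p f < ennreal e"
    using f e by (auto simp: Lclosure_def)
  have "Ldist \<alpha> \<mu> (\<lambda>x. c * p x) (\<lambda>x. c * f x) \<le> ennreal (cmod c powr \<alpha>) * ennreal e"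
    using assms(1) p by (subst Ldist_scale) (auto intro!: mult_left_mono)
  then show "\<exists>p\<in>P. Ldist \<alpha> \<mu> p (\<lambda>x. c * f x) \<le> ennreal (cmod c powr \<alpha>) * ennreal e"
    using P[OF p(1)] by blast
qed (use assms in auto)

lemma Lclosure_Lclosure:
  assumes "\<alpha> > 0" "P \<subseteq> borel_measurable \<mu>"
  shows "Lclosure \<alpha> \<mu> (Lclosure \<alpha> \<mu> P) \<subseteq> Lclosure \<alpha> \<mu> P"
proof
  fix f assume f: "f \<in> Lclosure \<alpha> \<mu> (Lclosure \<alpha> \<mu> P)"
  show "f \<in> Lclosure \<alpha> \<mu> P"
  proof (rule Lclosure_bound)
    show mf: "f \<in> borel_measurable \<mu>" using f by (auto simp: Lclosure_def)
    fix e :: real assume e: "e > 0"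
    obtain g where g: "g \<in> Lclosure \<alpha> \<mu> P" "Ldist \<alpha> \<mu> g f < ennreal (e / 2)"
      using f e half_gt_zero unfolding Lclosure_def[of _ _ "Lclosure _ _ _"] by blast
    obtain p where p: "p \<in> P" "Ldist \<alpha> \<mu> p g < ennreal (e / 2)"
      using g(1) e half_gt_zero unfolding Lclosure_def by blast
    have "Ldist \<alpha> \<mu> p f \<le> ennreal (2 powr \<alpha>) * (Ldist \<alpha> \<mu> p g + Ldist \<alpha> \<mu> g f)"
      using assms p g mf by (intro Ldist_triangle) (auto simp: Lclosure_def)
    also have "\<dots> \<le> ennreal (2 powr \<alpha>) * (ennreal (e / 2) + ennreal (e / 2))"
      using p g by (intro mult_left_mono add_mono) auto
    also have "ennreal (e / 2) + ennreal (e / 2) = ennreal e"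
      using e by (simp flip: ennreal_plus)
    finally show "\<exists>p\<in>P. Ldist \<alpha> \<mu> p f \<le> ennreal (2 powr \<alpha>) * ennreal e"
      using p(1) by blast
  qed (use assms in auto)
qed

text \<open>
  The usual reduction to indicators: \<open>f\<close> is the pointwise limit of simple functions \<open>s i\<close> with
  \<open>\<bar>s i\<bar> \<le> 2 * \<bar>f\<bar>\<close>, so \<open>\<bar>s i - f\<bar> powr \<alpha>\<close> is dominated by \<open>(3 * \<bar>f\<bar>) powr \<alpha>\<close>.
\<close>

lemma Lspace_subset_Lclosure:
  assumes "\<alpha> > 0" "P \<subseteq> borel_measurable \<mu>"
    and zero: "(\<lambda>_. 0) \<in> P"
    and add: "\<And>p q. p \<in> P \<Longrightarrow> q \<in> P \<Longrightarrow> (\<lambda>x. p x + q x) \<in> P"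
    and scale: "\<And>c p. p \<in> P \<Longrightarrow> (\<lambda>x. c * p x) \<in> P"
    and ind: "\<And>B. B \<in> sets \<mu> \<Longrightarrow> (indicator B :: 'a \<Rightarrow> complex) \<in> Lclosure \<alpha> \<mu> P"
  shows "Lspace \<alpha> \<mu> \<subseteq> Lclosure \<alpha> \<mu> P"
proof
  fix f assume f: "f \<in> Lspace \<alpha> \<mu>"
  then have mf [measurable]: "f \<in> borel_measurable \<mu>"
    and ff: "(\<integral>\<^sup>+x. ennreal (cmod (f x) powr \<alpha>) \<partial>\<mu>) < \<infinity>"
    by (auto simp: Lspace_def)
  have zero': "(\<lambda>_. 0) \<in> Lclosure \<alpha> \<mu> P"
    using zero by (auto simp: Lclosure_def Ldist_def intro!: bexI[OF _ zero])
  have sum: "(\<lambda>x. \<Sum>i\<in>I. c i * indicator (B i) x) \<in> Lclosure \<alpha> \<mu> P"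
    if "finite I" "\<And>i. i \<in> I \<Longrightarrow> B i \<in> sets \<mu>" for I :: "complex set" and c B
    using that
  proof (induction I rule: finite_induct)
    case (insert i I)
    have "(\<lambda>x. c i * indicator (B i) x + (\<Sum>i\<in>I. c i * indicator (B i) x)) \<in> Lclosure \<alpha> \<mu> P"
      using insert by (intro Lclosure_add Lclosure_scale assms) auto
    then show ?case by (simp only: sum.insert[OF insert.hyps])
  qed (simp add: zero')
  obtain s where s: "\<And>i. simple_function \<mu> (s i)" "\<And>x. x \<in> space \<mu> \<Longrightarrow> (\<lambda>i. s i x) \<longlonglongrightarrow> f x"
    "\<And>i x. x \<in> space \<mu> \<Longrightarrow> cmod (s i x) \<le> 2 * cmod (f x)"
    using borel_measurable_implies_sequence_metric[OF mf, of 0]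
    by (auto simp: Ball_def)
  have ms [measurable]: "s i \<in> borel_measurable \<mu>" for i
    using s(1) by (rule borel_measurable_simple_function)
  have sP: "s i \<in> Lclosure \<alpha> \<mu> P" for i
  proof -
    define t where "t x = (\<Sum>y\<in>s i ` space \<mu>. y * indicator (s i -` {y} \<inter> space \<mu>) x)" for x
    have fin: "finite (s i ` space \<mu>)" and "\<And>y. s i -` {y} \<inter> space \<mu> \<in> sets \<mu>"
      using s(1)[of i] by (auto simp: simple_function_def intro: measurable_sets[OF ms])
    then have t: "t \<in> Lclosure \<alpha> \<mu> P"
      unfolding t_def by (intro sum) auto
    have "s i x = t x" if "x \<in> space \<mu>" for x
    proof -
      have "t x = (\<Sum>y\<in>s i ` space \<mu>. if y = s i x then y else 0)"
        using that unfolding t_def by (intro sum.cong) (auto simp: indicator_def)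
      then show ?thesis using fin that by simp
    qed
    then have "Ldist \<alpha> \<mu> p (s i) = Ldist \<alpha> \<mu> p t" for p
      unfolding Ldist_def by (intro nn_integral_cong) simp
    then show ?thesis using t ms by (simp add: Lclosure_def)
  qed
  have "(\<lambda>i. Ldist \<alpha> \<mu> (s i) f) \<longlonglongrightarrow> (\<integral>\<^sup>+x. 0 \<partial>\<mu>)"
    unfolding Ldist_def
  proof (rule nn_integral_dominated_convergence)
    show "(\<integral>\<^sup>+x. ennreal (3 powr \<alpha>) * ennreal (cmod (f x) powr \<alpha>) \<partial>\<mu>) < \<infinity>"
      using ff by (simp add: nn_integral_cmult ennreal_mult_less_top)
    show "AE x in \<mu>. ennreal (cmod (s i x - f x) powr \<alpha>) \<le> ennreal (3 powr \<alpha>) * ennreal (cmod (f x) powr \<alpha>)" for i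
    proof (rule AE_I2)
      fix x assume x: "x \<in> space \<mu>"
      have "cmod (s i x - f x) \<le> 3 * cmod (f x)"
        using norm_triangle_ineq4[of "s i x" "f x"] s(3)[OF x, of i] by linarith
      then have "cmod (s i x - f x) powr \<alpha> \<le> (3 * cmod (f x)) powr \<alpha>"
        using assms(1) by (intro powr_mono2) auto
      then show "ennreal (cmod (s i x - f x) powr \<alpha>) \<le> ennreal (3 powr \<alpha>) * ennreal (cmod (f x) powr \<alpha>)"
        by (simp add: powr_mult flip: ennreal_mult)
    qed
    show "AE x in \<mu>. (\<lambda>i. ennreal (cmod (s i x - f x) powr \<alpha>)) \<longlonglongrightarrow> 0"
    proof (rule AE_I2)
      fix x assume x: "x \<in> space \<mu>"
      have "(\<lambda>i. cmod (s i x - f x)) \<longlonglongrightarrow> 0"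
        using s(2)[OF x] by (simp add: tendsto_norm_zero_iff LIM_zero_iff)
      then have "(\<lambda>i. cmod (s i x - f x) powr \<alpha>) \<longlonglongrightarrow> 0 powr \<alpha>"
        using assms(1) by (intro tendsto_powr2) auto
      then show "(\<lambda>i. ennreal (cmod (s i x - f x) powr \<alpha>)) \<longlonglongrightarrow> 0"
        using tendsto_ennrealI by fastforce
    qed
  qed measurable
  then have lim: "(\<lambda>i. Ldist \<alpha> \<mu> (s i) f) \<longlonglongrightarrow> 0" by simp
  have "\<exists>g\<in>Lclosure \<alpha> \<mu> P. Ldist \<alpha> \<mu> g f < ennreal e" if "e > 0" for e
    using order_tendstoD(2)[OF lim, of "ennreal e"] that sP by (auto simp: eventually_sequentially)
  then have "f \<in> Lclosure \<alpha> \<mu> (Lclosure \<alpha> \<mu> P)"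
    using mf unfolding Lclosure_def[of _ _ "Lclosure _ _ _"] by auto
  then show "f \<in> Lclosure \<alpha> \<mu> P"
    using Lclosure_Lclosure assms by blast
qed

lemma bounded_in_Lspace:
  assumes "finite_measure \<mu>" "\<alpha> > 0" "f \<in> borel_measurable \<mu>" "\<And>x. cmod (f x) \<le> B"
  shows "f \<in> Lspace \<alpha> \<mu>"
proof -
  interpret finite_measure \<mu> by fact
  have "(\<integral>\<^sup>+x. ennreal (cmod (f x) powr \<alpha>) \<partial>\<mu>) \<le> (\<integral>\<^sup>+x. ennreal (B powr \<alpha>) \<partial>\<mu>)"
    using assms by (intro nn_integral_mono ennreal_leI powr_mono2) auto
  also have "\<dots> < \<infinity>"
    by (simp add: ennreal_mult_less_top emeasure_eq_measure)
  finally show ?thesis using assms(3) by (simp add: Lspace_def)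
qed

section \<open>Density on a transversal\<close>

lemma regular_inner_compact:
  assumes \<mu>: "regular_borel_measure \<mu>" and B: "B \<in> sets borel" and e: "e > 0"
  obtains C where "compact C" "C \<subseteq> B" "measure \<mu> (B - C) < e"
proof -
  interpret finite_measure \<mu> using \<mu> by (simp add: regular_borel_measure_def)
  obtain C U where C: "compact C" "open U" "C \<subseteq> B" "B \<subseteq> U" "measure \<mu> (U - C) < e"
    using \<mu> B e unfolding regular_borel_measure_def by blast
  have "measure \<mu> (B - C) \<le> measure \<mu> (U - C)"
    using C \<mu> by (intro finite_measure_mono)
      (auto simp: regular_borel_measure_def intro: compact_imp_closed borel_open)
  then show ?thesis using that C by force
qed

text \<open>
  Two points of \<open>D\<close> whose difference annihilates \<open>H\<close> coincide, so real \<open>H\<close>-polynomials separate the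
  points of \<open>C1 \<union> C2\<close>. The indicator of \<open>B\<close> is continuous there, being constant on each of two
  disjoint closed pieces.
\<close>

lemma real_trig_poly_near_indicator:
  assumes H: "additive_subgroup H"
    and D: "\<And>\<delta>. \<delta> \<in> annihilator H - {0} \<Longrightarrow> D \<inter> (+) \<delta> ` D = {}"
    and C1: "compact C1" "C1 \<subseteq> D \<inter> B" and C2: "compact C2" "C2 \<subseteq> D - B" and e: "e > 0"
  shows "\<exists>g. (\<lambda>\<gamma>. complex_of_real (g \<gamma>)) \<in> trig_polys H \<and>
    (\<forall>\<gamma>\<in>C1 \<union> C2. \<bar>g \<gamma> - indicator B \<gamma>\<bar> < e) \<and> (\<forall>\<gamma>. \<bar>g \<gamma>\<bar> \<le> 1 + e)"
proof -
  let ?R = "{r. (\<lambda>\<gamma>. complex_of_real (r \<gamma>)) \<in> trig_polys H}"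
  have "\<exists>g\<in>?R. (\<forall>\<gamma>\<in>C1 \<union> C2. \<bar>g \<gamma> - indicator B \<gamma>\<bar> < e) \<and> (\<forall>\<gamma>. \<bar>g \<gamma>\<bar> \<le> 1 + e)"
  proof (rule Stone_Weierstrass_bounded)
    show "continuous_on (C1 \<union> C2) r" if "r \<in> ?R" for r
    proof -
      have "continuous_on UNIV (\<lambda>\<gamma>. Re (complex_of_real (r \<gamma>)))"
        using that by (intro continuous_on_Re continuous_trig_poly) auto
      then show ?thesis by (auto intro: continuous_on_subset)
    qed
    show "\<exists>M. \<forall>x. \<bar>r x\<bar> \<le> M" if "r \<in> ?R" for r
      using that bounded_trig_poly[of "\<lambda>\<gamma>. complex_of_real (r \<gamma>)"] by auto
    show "\<exists>r\<in>?R. r x \<noteq> r y" if "x \<in> C1 \<union> C2" "y \<in> C1 \<union> C2" "x \<noteq> y" for x y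
    proof -
      have "x - y \<notin> annihilator H"
      proof
        assume "x - y \<in> annihilator H"
        then have "D \<inter> (+) (x - y) ` D = {}"
          using that by (intro D) auto
        moreover have "x = (x - y) + y" "x \<in> D" "y \<in> D"
          using that C1 C2 by auto
        ultimately show False by blast
      qed
      then show ?thesis
        using real_trig_polys_separate[OF H] by blast
    qed
    have "continuous_on C1 (indicator B :: _ \<Rightarrow> real)" "continuous_on C2 (indicator B :: _ \<Rightarrow> real)"
      using C1 C2 by (auto intro!: continuous_on_eq[OF continuous_on_const] simp: indicator_def subset_iff)
    then show "continuous_on (C1 \<union> C2) (indicator B :: _ \<Rightarrow> real)"
      using C1 C2 by (intro continuous_on_closed_Un compact_imp_closed)
  qed (use C1 C2 e H in \<open>auto intro: trig_polys_const trig_polys_add trig_polys_mult simp: indicator_def\<close>)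
  then show ?thesis by auto
qed

text \<open>
  The error splits into the part on \<open>C1 \<union> C2\<close>, where the integrand is at most \<open>d powr \<alpha> \<le> e\<close>, and
  the part on its complement \<open>N\<close>, which has measure at most \<open>2 * e\<close> and where the integrand is at
  most \<open>3 powr \<alpha>\<close> by the global bound on the approximant.
\<close>

lemma indicator_in_Lclosure_trig_polys:
  fixes \<mu> :: "'g::{topological_ab_group_add, t2_space} dual_group measure"
  assumes H: "additive_subgroup H" and \<mu>: "regular_borel_measure \<mu>" and \<alpha>: "\<alpha> > 0"
    and conc: "concentrated_on_transversal H \<mu>" and B: "B \<in> sets borel"
  shows "(indicator B :: _ \<Rightarrow> complex) \<in> Lclosure \<alpha> \<mu> (trig_polys H)"
proof -
  interpret finite_measure \<mu> using \<mu> by (simp add: regular_borel_measure_def)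
  have sets [measurable_cong]: "sets \<mu> = sets borel"
    using \<mu> by (simp add: regular_borel_measure_def)
  have space [simp]: "space \<mu> = UNIV"
    using sets_eq_imp_space_eq[OF sets] by simp
  note [measurable] = B
  obtain D where D: "D \<in> sets borel" "emeasure \<mu> (- D) = 0"
    and DD: "\<And>\<delta>. \<delta> \<in> annihilator H - {0} \<Longrightarrow> D \<inter> (+) \<delta> ` D = {}"
    using conc by (auto simp: concentrated_on_transversal_def)
  note [measurable] = D(1)
  define M where "M = measure \<mu> UNIV"
  have M: "M \<ge> 0" by (simp add: M_def)
  show ?thesis
  proof (rule Lclosure_bound)
    show "trig_polys H \<subseteq> borel_measurable \<mu>"
      using continuous_trig_poly borel_measurable_continuous_onI measurable_cong_sets[OF sets refl] by blast
    show "M + 3 powr \<alpha> * 2 \<ge> 0" using M by simp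
    fix e :: real assume e: "e > 0"
    \<comment> \<open>The uniform error is below \<open>e powr (1 / \<alpha>)\<close> for the estimate on the compact set,
      and at most \<open>1\<close> so that the global bound \<open>1 + d\<close> does not exceed \<open>2\<close>.\<close>
    define d where "d = min 1 (e powr (1 / \<alpha>))"
    have d: "0 < d" "d \<le> 1" "d powr \<alpha> \<le> e"
    proof -
      have "d powr \<alpha> \<le> (e powr (1 / \<alpha>)) powr \<alpha>"
        using \<alpha> e by (intro powr_mono2) (auto simp: d_def)
      then show "d powr \<alpha> \<le> e" using \<alpha> e by (simp add: powr_powr)
    qed (use e in \<open>auto simp: d_def\<close>)
    obtain C1 where C1: "compact C1" "C1 \<subseteq> D \<inter> B" "measure \<mu> (D \<inter> B - C1) < e"
      using regular_inner_compact[OF \<mu> _ e, of "D \<inter> B"] D B by blast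
    obtain C2 where C2: "compact C2" "C2 \<subseteq> D - B" "measure \<mu> (D - B - C2) < e"
      using regular_inner_compact[OF \<mu> _ e, of "D - B"] D B by blast
    obtain g where g: "(\<lambda>\<gamma>. complex_of_real (g \<gamma>)) \<in> trig_polys H"
      "\<And>\<gamma>. \<gamma> \<in> C1 \<union> C2 \<Longrightarrow> \<bar>g \<gamma> - indicator B \<gamma>\<bar> < d" "\<And>\<gamma>. \<bar>g \<gamma>\<bar> \<le> 1 + d"
      using real_trig_poly_near_indicator[OF H DD C1(1,2) C2(1,2) d(1)] by blast
    have [measurable]: "C1 \<in> sets borel" "C2 \<in> sets borel"
      using C1 C2 by (auto intro: borel_closed compact_imp_closed)
    define N where "N = - (C1 \<union> C2)"
    have [measurable]: "N \<in> sets borel" unfolding N_def by measurable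
    have "measure \<mu> N \<le> measure \<mu> (- D \<union> ((D \<inter> B - C1) \<union> (D - B - C2)))"
      unfolding N_def by (intro finite_measure_mono) (auto simp: sets)
    also have "\<dots> \<le> measure \<mu> (- D) + measure \<mu> ((D \<inter> B - C1) \<union> (D - B - C2))"
      by (intro measure_Un_le) (auto simp: sets)
    also have "measure \<mu> ((D \<inter> B - C1) \<union> (D - B - C2)) \<le> measure \<mu> (D \<inter> B - C1) + measure \<mu> (D - B - C2)"
      by (intro measure_Un_le) (auto simp: sets)
    also have "measure \<mu> (- D) = 0" using D by (simp add: measure_def)
    finally have N: "measure \<mu> N \<le> 2 * e" using C1 C2 by simp
    have bound: "cmod (complex_of_real (g x) - indicator B x) powr \<alpha> \<le> e + 3 powr \<alpha> * indicator N x" for x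
    proof -
      have eq: "cmod (complex_of_real (g x) - indicator B x) = \<bar>g x - indicator B x\<bar>"
        by (metis norm_of_real of_real_diff of_real_indicator)
      show ?thesis
      proof (cases "x \<in> N")
        case True
        have "\<bar>g x - indicator B x\<bar> \<le> 3"
          using g(3)[of x] d by (auto simp: indicator_def)
        then have "\<bar>g x - indicator B x\<bar> powr \<alpha> \<le> 3 powr \<alpha>"
          using \<alpha> by (intro powr_mono2) auto
        then show ?thesis using True e eq by simp
      next
        case False
        then have "\<bar>g x - indicator B x\<bar> powr \<alpha> \<le> d powr \<alpha>"
          using \<alpha> g(2)[of x] by (intro powr_mono2) (auto simp: N_def)
        then show ?thesis using False d eq by simp
      qed
    qed
    have "Ldist \<alpha> \<mu> (\<lambda>\<gamma>. complex_of_real (g \<gamma>)) (indicator B) \<le>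
        (\<integral>\<^sup>+x. ennreal e + ennreal (3 powr \<alpha>) * indicator N x \<partial>\<mu>)"
      unfolding Ldist_def
    proof (rule nn_integral_mono)
      fix x
      have "ennreal e + ennreal (3 powr \<alpha>) * indicator N x = ennreal (e + 3 powr \<alpha> * indicator N x)"
        using e by (auto simp: indicator_def)
      then show "ennreal (cmod (complex_of_real (g x) - indicator B x) powr \<alpha>) \<le>
          ennreal e + ennreal (3 powr \<alpha>) * indicator N x"
        using bound[of x] by (simp add: ennreal_leI)
    qed
    also have "\<dots> = ennreal e * ennreal M + ennreal (3 powr \<alpha>) * ennreal (measure \<mu> N)"
      by (simp add: nn_integral_add nn_integral_cmult emeasure_eq_measure M_def)
    also have "\<dots> = ennreal (e * M + 3 powr \<alpha> * measure \<mu> N)"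
      using e M by (simp add: ennreal_mult)
    also have "\<dots> \<le> ennreal ((M + 3 powr \<alpha> * 2) * e)"
      using N by (intro ennreal_leI) (simp add: algebra_simps)
    also have "\<dots> = ennreal (M + 3 powr \<alpha> * 2) * ennreal e"
      using M e by (intro ennreal_mult) auto
    finally show "\<exists>p\<in>trig_polys H. Ldist \<alpha> \<mu> p (indicator B) \<le> ennreal (M + 3 powr \<alpha> * 2) * ennreal e"
      using g(1) by blast
  qed measurable
qed

section \<open>A transversal from density\<close>

text \<open>
  Balls with centres in a countable dense set and radii \<open>1 / (n + 1)\<close>: a radius below half the distance
  of two points keeps them from lying in the same ball.
\<close>

lemma polish_countable_separating_opens:
  assumes "polish_topology (euclidean :: 'a::topological_space topology)"
  shows "\<exists>\<U> :: 'a set set. countable \<U> \<and> (\<forall>U\<in>\<U>. open U) \<and>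
    (\<forall>x y. x \<noteq> y \<longrightarrow> (\<exists>U\<in>\<U>. x \<in> U \<and> y \<notin> U))"
proof -
  have "metrizable_space (euclidean :: 'a topology)"
    using assms by (simp add: polish_topology_def completely_metrizable_imp_metrizable_space)
  then obtain S :: "'a set" and d where md: "Metric_space S d" "euclidean = Metric_space.mtopology S d"
    unfolding metrizable_space_def by blast
  interpret Metric_space S d by fact
  have S: "x \<in> S" for x
    using md(2) by (metis UNIV_I topspace_euclidean topspace_mtopology)
  obtain A :: "'a set" where A: "countable A" "closure A = UNIV"
    using assms by (auto simp: polish_topology_def separable_space_def)
  define \<U> where "\<U> = (\<lambda>(a, n). mball a (1 / real (Suc n))) ` (A \<times> (UNIV :: nat set))"
  have op: "open (mball a r)" for a r
    using openin_mball[of a r] md(2) by (simp add: open_openin)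
  show ?thesis
  proof (intro exI[of _ \<U>] conjI ballI allI impI)
    show "countable \<U>" unfolding \<U>_def using A by auto
    show "open U" if "U \<in> \<U>" for U using that op by (auto simp: \<U>_def)
    fix x y :: 'a assume "x \<noteq> y"
    then have "d x y / 2 > 0" using S mdist_pos_less by simp
    then obtain n where n: "1 / real (Suc n) < d x y / 2"
      using nat_approx_posE by metis
    have "x \<in> closure A" "x \<in> mball x (1 / real (Suc n))" using A S by auto
    then obtain a where a: "a \<in> A" "a \<in> mball x (1 / real (Suc n))"
      using op[of x "1 / real (Suc n)"] unfolding closure_iff_nhds_not_empty
      by (metis disjoint_iff subset_refl)
    have "x \<in> mball a (1 / real (Suc n))"
      using a S by (simp add: commute)
    moreover have "y \<notin> mball a (1 / real (Suc n))"
    proof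
      assume "y \<in> mball a (1 / real (Suc n))"
      then have "d a y < 1 / real (Suc n)" "d x a < 1 / real (Suc n)" using a by auto
      moreover have "d x y \<le> d x a + d a y" using S triangle by simp
      ultimately show False using n by linarith
    qed
    ultimately show "\<exists>U\<in>\<U>. x \<in> U \<and> y \<notin> U"
      using a(1) unfolding \<U>_def by (intro bexI[of _ "mball a (1 / real (Suc n))"]) auto
  qed
qed

text \<open>
  Countability of the separating family is what allows a single null set to be discarded for all
  its members at once.
\<close>

lemma dense_imp_concentrated:
  fixes \<mu> :: "'g::{topological_ab_group_add, t2_space} dual_group measure"
  assumes sets: "sets \<mu> = sets borel" and fin: "finite_measure \<mu>" and \<alpha>: "\<alpha> > 0"
    and polish: "polish_topology (euclidean :: 'g dual_group topology)"
    and dense: "dense_in_Lspace \<alpha> \<mu> (trig_polys H)"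
  shows "concentrated_on_transversal H \<mu>"
proof -
  have space [simp]: "space \<mu> = UNIV"
    using sets_eq_imp_space_eq[OF sets] by simp
  obtain \<U> :: "'g dual_group set set" where \<U>_props: "countable \<U> \<and> (\<forall>U\<in>\<U>. open U) \<and>
      (\<forall>x y. x \<noteq> y \<longrightarrow> (\<exists>U\<in>\<U>. x \<in> U \<and> y \<notin> U))"
    using polish_countable_separating_opens[OF polish] ..
  have \<U>: "countable \<U>" "\<And>U. U \<in> \<U> \<Longrightarrow> open U"
    "\<And>x y. x \<noteq> y \<Longrightarrow> \<exists>U\<in>\<U>. x \<in> U \<and> y \<notin> U"
    using \<U>_props by simp_all
  have "\<exists>F. (\<forall>n. F n \<in> trig_polys H) \<and> (AE x in \<mu>. (\<lambda>n. F n x) \<longlonglongrightarrow> indicator U x)"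
    if U: "U \<in> \<U>" for U
  proof -
    have "U \<in> sets \<mu>" using \<U>(2)[OF U] sets by simp
    then have ind: "(indicator U :: _ \<Rightarrow> complex) \<in> Lspace \<alpha> \<mu>"
      using fin \<alpha> by (intro bounded_in_Lspace[of _ _ _ 1]) (auto simp: indicator_def)
    then obtain F where F: "\<And>n. F n \<in> trig_polys H" "Lconverges \<alpha> \<mu> F (indicator U)"
      using dense unfolding dense_in_Lspace_def by blast
    then have "F n \<in> Lspace \<alpha> \<mu>" for n
      using dense unfolding dense_in_Lspace_def by blast
    from Lconverges_AE_subseq[OF \<alpha> this ind F(2)]
    obtain s where "AE x in \<mu>. (\<lambda>n. F (s n) x) \<longlonglongrightarrow> indicator U x" by blast
    then show ?thesis using F(1) by (intro exI[of _ "\<lambda>n. F (s n)"]) auto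
  qed
  then obtain F where F: "\<And>U n. U \<in> \<U> \<Longrightarrow> F U n \<in> trig_polys H"
    "\<And>U. U \<in> \<U> \<Longrightarrow> AE x in \<mu>. (\<lambda>n. F U n x) \<longlonglongrightarrow> indicator U x"
    by metis
  have "AE x in \<mu>. \<forall>U\<in>\<U>. (\<lambda>n. F U n x) \<longlonglongrightarrow> indicator U x"
    using F(2) \<U>(1) by (simp add: AE_ball_countable)
  then obtain N where N: "N \<in> null_sets \<mu>"
    "{x. \<not> (\<forall>U\<in>\<U>. (\<lambda>n. F U n x) \<longlonglongrightarrow> indicator U x)} \<subseteq> N"
    by (auto simp: eventually_ae_filter)
  have lim: "(\<lambda>n. F U n x) \<longlonglongrightarrow> indicator U x" if "x \<in> - N" "U \<in> \<U>" for x U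
    using N that by blast
  have "- N \<inter> (+) \<delta> ` (- N) = {}" if \<delta>: "\<delta> \<in> annihilator H - {0}" for \<delta>
  proof (rule ccontr)
    assume "- N \<inter> (+) \<delta> ` (- N) \<noteq> {}"
    then obtain \<gamma> where \<gamma>: "\<gamma> \<in> - N" "\<delta> + \<gamma> \<in> - N" by auto
    have "\<gamma> \<noteq> \<delta> + \<gamma>" using \<delta> by simp
    then obtain U where U: "U \<in> \<U>" "\<gamma> \<in> U" "\<delta> + \<gamma> \<notin> U" using \<U>(3) by blast
    have "F U n (\<delta> + \<gamma>) = F U n \<gamma>" for n
      using F(1)[OF U(1)] \<delta> by (intro trig_poly_annihilator_invariant[of _ H]) auto
    then have "indicator U (\<delta> + \<gamma>) = (indicator U \<gamma> :: complex)"
      using lim[OF \<gamma>(1) U(1)] lim[OF \<gamma>(2) U(1)] by (simp add: LIMSEQ_unique)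
    then show False using U by simp
  qed
  moreover have "- N \<in> sets borel" "emeasure \<mu> (- (- N)) = 0"
    using N sets by (auto simp: null_sets_def)
  ultimately show ?thesis
    unfolding concentrated_on_transversal_def by blast
qed

theorem theorem4p4:
  fixes H :: "'g::{topological_ab_group_add, t2_space} set"
    and \<mu> :: "'g dual_group measure"
    and \<alpha> :: real
  assumes "locally_compact_space (euclidean :: 'g topology)"
    and "closed H" and "additive_subgroup H"
    and "regular_borel_measure \<mu>"
    and "\<alpha> > 0"
    and "polish_topology (euclidean :: 'g dual_group topology)"
  shows "dense_in_Lspace \<alpha> \<mu> (trig_polys H) \<longleftrightarrow> concentrated_on_transversal H \<mu>"
proof
  have sets: "sets \<mu> = sets borel" and fin: "finite_measure \<mu>"
    using assms(4) by (auto simp: regular_borel_measure_def)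
  {
    assume "dense_in_Lspace \<alpha> \<mu> (trig_polys H)"
    then show "concentrated_on_transversal H \<mu>"
      using dense_imp_concentrated sets fin assms(5,6) by blast
  next
    assume conc: "concentrated_on_transversal H \<mu>"
    have meas: "trig_polys H \<subseteq> borel_measurable \<mu>"
      using continuous_trig_poly borel_measurable_continuous_onI measurable_cong_sets[OF sets refl] by blast
    have "trig_polys H \<subseteq> Lspace \<alpha> \<mu>"
      using meas bounded_trig_poly bounded_in_Lspace[OF fin assms(5)] by blast
    moreover have "Lspace \<alpha> \<mu> \<subseteq> Lclosure \<alpha> \<mu> (trig_polys H)"
    proof (rule Lspace_subset_Lclosure[OF assms(5) meas])
      show "(\<lambda>\<gamma>. c * p \<gamma>) \<in> trig_polys H" if "p \<in> trig_polys H" for c p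
        using trig_polys_mult[OF assms(3) trig_polys_const[OF assms(3)] that] .
      show "(indicator B :: _ \<Rightarrow> complex) \<in> Lclosure \<alpha> \<mu> (trig_polys H)" if "B \<in> sets \<mu>" for B
        using that sets indicator_in_Lclosure_trig_polys[OF assms(3,4,5) conc] by simp
    qed (auto intro: trig_polys_zero trig_polys_add)
    ultimately show "dense_in_Lspace \<alpha> \<mu> (trig_polys H)"
      by (simp add: dense_in_Lspace_iff)
  }
qed

end
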